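(* Let $\mathcal R$ be a TRS, and let $\mu_{\mathsf i}$ and $\mu_{\mathsf t}$ be its innermost usable replacement map and its usable replacement map, respectively. Then: (i) every term $t$ with $s \,(\xrightarrow{i}_{\mathcal R})^{*}\, t$ for some $s\in\mathcal T(\varnothing)$ belongs to $\mathcal T(\mu_{\mathsf i})$; (ii) every term $t$ with $s \to_{\mathcal R}^{*} t$ for some $s\in\mathcal T(\varnothing)$ belongs to $\mathcal T(\mu_{\mathsf t})$.
   Context: Let $\mathcal F$ be a finite signature and $\mathcal V$ a countably infinite set of variables; $\mathcal T(\mathcal F,\mathcal V)$ is the set of terms. A TRS $\mathcal R$ is a finite set of rules $l\to r$ with $l\notin\mathcal V$ and $\mathrm{Var}(r)\subseteq\mathrm{Var}(l)$; $\to_{\mathcal R}$ is its rewrite relation, $\mathrm{NF}(\mathcal R)$ its set of normal forms. The innermost rewrite relation: $s\xrightarrow{i}_{\mathcal R}t$ iff $s=C[l\sigma]$, $t=C[r\sigma]$ for a rule $l\to r\in\mathcal R$, a context $C$ and a substitution $\sigma$ such that all proper subterms of $l\sigma$ are in $\mathrm{NF}(\mathcal R)$. A replacement map $\mu$ assigns to each $n$-ary symbol $f$ ($n\ge 1$) a set $\mu(f)\subseteq\{1,\dots,n\}$; it is identified with the set of pairs $(f,i)$ with $i\in\mu(f)$, and replacement maps are ordered by inclusion. The $\mu$-replacing positions are $\mathrm{Pos}_\mu(x)=\{\epsilon\}$ for variables $x$ and $\mathrm{Pos}_\mu(f(t_1,\dots,t_n))=\{\epsilon\}\cup\{ip\mid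 i\in\mu(f),\ p\in\mathrm{Pos}_\mu(t_i)\}$; $\mathrm{NPos}_\mu(t)=\mathrm{Pos}(t)\setminus\mathrm{Pos}_\mu(t)$. $\mathcal T(\mu)$ is the set of terms $t$ such that for every position $p$ of $t$, $t|_p\notin\mathrm{NF}(\mathcal R)$ implies $p\in\mathrm{Pos}_\mu(t)$. For terms $s,t$, $\mathrm{CAP}^s_\mu(t)$ is defined recursively on $t$: it is $t$ if $t=s|_p$ for some $p\in\mathrm{NPos}_\mu(s)$; otherwise, if $t=f(t_1,\dots,t_n)$ and $u:=f(\mathrm{CAP}^s_\mu(t_1),\dots,\mathrm{CAP}^s_\mu(t_n))$ unifies with no left-hand side $l$ of a rule of $\mathcal R$ (variables of $l$ renamed apart from $u$), it is $u$; in all other cases it is a fresh variable. Define $\Upsilon(\mu)=\{(f,i)\mid \text{there is } l\to r\in\mathcal R \text{ and a subterm } f(r_1,\dots,r_n) \text{ of } r \text{ with } \mathrm{CAP}^l_\mu(r_i)\neq r_i\}$. $\Upsilon$ is monotone; the innermost usable replacement map is $\mu_{\mathsf i}=\Upsilon(\varnothing)$ and the usable replacement map $\mu_{\mathsf t}$ is the least fixed point of $\Upsilon$. *)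

theory Defs
  imports Main "HOL-Library.Countable" "HOL-Library.Infinite_Typeclass"
begin

section \<open>Terms\<close>

datatype (funs_trm: 'f, vars_trm: 'v) trm = Var 'v | Fun 'f "('f, 'v) trm list"

text \<open>A signature is a set \<open>F\<close> of symbols together with an arity function \<open>ar\<close>; the
  variables are all elements of the type \<open>'v\<close>.\<close>

inductive_set terms :: "'f set \<Rightarrow> ('f \<Rightarrow> nat) \<Rightarrow> ('f, 'v) trm set"
  for F :: "'f set" and ar :: "'f \<Rightarrow> nat" where
  "Var x \<in> terms F ar"
| "f \<in> F \<Longrightarrow> length ts = ar f \<Longrightarrow> (\<And>t. t \<in> set ts \<Longrightarrow> t \<in> terms F ar)
    \<Longrightarrow> Fun f ts \<in> terms F ar"

lemma size_arg [termination_simp]: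
  "Suc 0 \<le> i \<Longrightarrow> i \<le> length ts \<Longrightarrow> size (ts ! (i - Suc 0)) < Suc (size_list size ts)"
  using size_list_estimation'[of "ts ! (i - Suc 0)" ts "size (ts ! (i - Suc 0))" size]
  by (auto simp: less_Suc_eq_le)

text \<open>Positions are lists of argument indices, and arguments are counted from 1, so the
  \<open>i\<close>-th argument of \<open>Fun f ts\<close> is \<open>ts ! (i - 1)\<close>.\<close>

type_synonym pos = "nat list"

fun Pos :: "('f, 'v) trm \<Rightarrow> pos set" where
  "Pos (Var x) = {[]}"
| "Pos (Fun f ts) = {[]} \<union> (\<Union>i \<in> {1..length ts}. (#) i ` Pos (ts ! (i - 1)))"

fun subterm_at :: "('f, 'v) trm \<Rightarrow> pos \<Rightarrow> ('f, 'v) trm" where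
  "subterm_at t [] = t"
| "subterm_at (Fun f ts) (i # p) = subterm_at (ts ! (i - 1)) p"
| "subterm_at (Var x) (i # p) = undefined"

fun subst :: "('f, 'v) trm \<Rightarrow> ('v \<Rightarrow> ('f, 'w) trm) \<Rightarrow> ('f, 'w) trm"  (infixl "\<cdot>" 67) where
  "Var x \<cdot> \<sigma> = \<sigma> x"
| "Fun f ts \<cdot> \<sigma> = Fun f (map (\<lambda>t. t \<cdot> \<sigma>) ts)"

abbreviation rename :: "('v \<Rightarrow> 'w) \<Rightarrow> ('f, 'v) trm \<Rightarrow> ('f, 'w) trm" where
  "rename \<equiv> map_trm (\<lambda>f. f)"

text \<open>Unifiers may use arbitrary terms of the type; for terms over a signature this makes
  no difference, since a most general unifier then consists of terms over that signature.\<close>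

definition unifiable :: "('f, 'v) trm \<Rightarrow> ('f, 'v) trm \<Rightarrow> bool" where
  "unifiable s t \<longleftrightarrow> (\<exists>\<sigma> :: 'v \<Rightarrow> ('f, 'v) trm. s \<cdot> \<sigma> = t \<cdot> \<sigma>)"

text \<open>Renaming apart is made explicit by the two injections into a sum type.\<close>

definition unifiable_apart :: "('f, 'v) trm \<Rightarrow> ('f, 'w) trm \<Rightarrow> bool" where
  "unifiable_apart u l \<longleftrightarrow> unifiable (rename Inl u) (rename Inr l)"

datatype ('f, 'v) ctxt = Hole | More 'f "('f, 'v) trm list" "('f, 'v) ctxt" "('f, 'v) trm list"

fun plug :: "('f, 'v) ctxt \<Rightarrow> ('f, 'v) trm \<Rightarrow> ('f, 'v) trm" where
  "plug Hole t = t"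
| "plug (More f ss C ts) t = Fun f (ss @ plug C t # ts)"


section \<open>Rewriting\<close>

type_synonym ('f, 'v) rules = "(('f, 'v) trm \<times> ('f, 'v) trm) set"

definition trs :: "'f set \<Rightarrow> ('f \<Rightarrow> nat) \<Rightarrow> ('f, 'v) rules \<Rightarrow> bool" where
  "trs F ar R \<longleftrightarrow> finite R \<and>
    (\<forall>(l, r) \<in> R. l \<in> terms F ar \<and> r \<in> terms F ar \<and> l \<notin> range Var \<and> vars_trm r \<subseteq> vars_trm l)"

text \<open>The rewrite relations and normal forms are taken on the whole type; since rewriting
  with a TRS over a signature preserves well-formedness, they restrict to the intended notions
  on \<open>terms F ar\<close>.\<close>

definition rstep :: "('f, 'v) rules \<Rightarrow> ('f, 'v) trm rel" where
  "rstep R = {(s, t). \<exists>l r C \<sigma>. (l, r) \<in> R \<and> s = plug C (l \<cdot> \<sigma>) \<and> t = plug C (r \<cdot> \<sigma>)}"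

definition NF :: "('f, 'v) rules \<Rightarrow> ('f, 'v) trm set" where
  "NF R = {t. \<not> (\<exists>u. (t, u) \<in> rstep R)}"

definition innermost_rstep :: "('f, 'v) rules \<Rightarrow> ('f, 'v) trm rel" where
  "innermost_rstep R = {(s, t). \<exists>l r C \<sigma>. (l, r) \<in> R \<and> s = plug C (l \<cdot> \<sigma>) \<and> t = plug C (r \<cdot> \<sigma>) \<and>
     (\<forall>p \<in> Pos (l \<cdot> \<sigma>). p \<noteq> [] \<longrightarrow> subterm_at (l \<cdot> \<sigma>) p \<in> NF R)}"


section \<open>Replacement maps\<close>

type_synonym 'f repl_map = "('f \<times> nat) set"

definition replacement_map :: "'f set \<Rightarrow> ('f \<Rightarrow> nat) \<Rightarrow> 'f repl_map \<Rightarrow> bool" where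
  "replacement_map F ar \<mu> \<longleftrightarrow> (\<forall>(f, i) \<in> \<mu>. f \<in> F \<and> 1 \<le> i \<and> i \<le> ar f)"

fun RPos :: "'f repl_map \<Rightarrow> ('f, 'v) trm \<Rightarrow> pos set" where
  "RPos \<mu> (Var x) = {[]}"
| "RPos \<mu> (Fun f ts) =
    {[]} \<union> (\<Union>i \<in> {1..length ts}. if (f, i) \<in> \<mu> then (#) i ` RPos \<mu> (ts ! (i - 1)) else {})"

definition NPos :: "'f repl_map \<Rightarrow> ('f, 'v) trm \<Rightarrow> pos set" where
  "NPos \<mu> t = Pos t - RPos \<mu> t"

definition T_mu :: "'f set \<Rightarrow> ('f \<Rightarrow> nat) \<Rightarrow> ('f, 'v) rules \<Rightarrow> 'f repl_map \<Rightarrow> ('f, 'v) trm set" where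
  "T_mu F ar R \<mu> =
    {t \<in> terms F ar. \<forall>p \<in> Pos t. subterm_at t p \<notin> NF R \<longrightarrow> p \<in> RPos \<mu> t}"


section \<open>Usable replacement maps\<close>

text \<open>The result of the capping function lives over original variables \<open>Orig x\<close> and fresh
  variables. A fresh variable is tagged with the position at which it is introduced, so
  different introductions yield different variables. Accordingly, the function carries the
  position \<open>q\<close> of its last argument in the term that is capped (initially \<open>[]\<close>).\<close>

datatype 'v cvar = Orig 'v | Fresh pos

fun cap_at :: "('f, 'v) rules \<Rightarrow> 'f repl_map \<Rightarrow> ('f, 'v) trm \<Rightarrow> pos \<Rightarrow> ('f, 'v) trm
    \<Rightarrow> ('f, 'v cvar) trm" where
  "cap_at R \<mu> s q (Var x) =
    (if \<exists>p \<in> NPos \<mu> s. Var x = subterm_at s p then Var (Orig x) else Var (Fresh q))"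
| "cap_at R \<mu> s q (Fun f ts) =
    (if \<exists>p \<in> NPos \<mu> s. Fun f ts = subterm_at s p then rename Orig (Fun f ts)
     else let u = Fun f (map (\<lambda>i. cap_at R \<mu> s (q @ [i]) (ts ! (i - 1))) [1..<Suc (length ts)])
       in if \<exists>(l, r) \<in> R. unifiable_apart u l then Var (Fresh q) else u)"

definition cap :: "('f, 'v) rules \<Rightarrow> 'f repl_map \<Rightarrow> ('f, 'v) trm \<Rightarrow> ('f, 'v) trm
    \<Rightarrow> ('f, 'v cvar) trm" where
  "cap R \<mu> s t = cap_at R \<mu> s [] t"

definition Upsilon :: "('f, 'v) rules \<Rightarrow> 'f repl_map \<Rightarrow> 'f repl_map" where
  "Upsilon R \<mu> = {(f, i). \<exists>l r p rs. (l, r) \<in> R \<and> p \<in> Pos r \<and> subterm_at r p = Fun f rs \<and>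
     1 \<le> i \<and> i \<le> length rs \<and> cap R \<mu> l (rs ! (i - 1)) \<noteq> rename Orig (rs ! (i - 1))}"

definition innermost_usable_map :: "('f, 'v) rules \<Rightarrow> 'f repl_map" where
  "innermost_usable_map R = Upsilon R {}"

text \<open>The library's \<open>lfp\<close> ranges over all sets of pairs. The lemmas below show that it is a
  replacement map and the least fixed point among replacement maps.\<close>

definition usable_map :: "('f, 'v) rules \<Rightarrow> 'f repl_map" where
  "usable_map R = lfp (Upsilon R)"

lemma RPos_mono: "\<mu> \<subseteq> \<nu> \<Longrightarrow> RPos \<mu> t \<subseteq> RPos \<nu> t"
proof (induction \<mu> t rule: RPos.induct)
  case (2 \<mu> f ts)
  have step: "(if (f, i) \<in> \<mu> then (#) i ` RPos \<mu> (ts ! (i - 1)) else {})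
      \<subseteq> (if (f, i) \<in> \<nu> then (#) i ` RPos \<nu> (ts ! (i - 1)) else {})"
    if "i \<in> {1..length ts}" for i
  proof (cases "(f, i) \<in> \<mu>")
    case True
    with 2(2) have "(f, i) \<in> \<nu>" by blast
    with True 2(1)[OF that True 2(2)] show ?thesis by (simp add: image_mono)
  qed simp
  then show ?case unfolding RPos.simps by (intro Un_mono UN_mono order_refl step)
qed simp

lemma NPos_antimono: "\<mu> \<subseteq> \<nu> \<Longrightarrow> NPos \<nu> t \<subseteq> NPos \<mu> t"
  unfolding NPos_def by (rule Diff_mono[OF order_refl RPos_mono])

lemma cap_at_antimono:
  assumes "\<mu> \<subseteq> \<nu>" and "cap_at R \<nu> s q t = rename Orig t"
  shows "cap_at R \<mu> s q t = rename Orig t"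
  using assms
proof (induction R \<nu> s q t rule: cap_at.induct)
  case (1 R \<nu> s q x)
  from 1(2) have "\<exists>p \<in> NPos \<nu> s. Var x = subterm_at s p"
    by (simp split: if_splits)
  then have "\<exists>p \<in> NPos \<mu> s. Var x = subterm_at s p"
    using NPos_antimono[OF 1(1), of s] by blast
  then show ?case by simp
next
  case (2 R \<nu> s q f ts)
  let ?args = "\<lambda>\<mu>. map (\<lambda>i. cap_at R \<mu> s (q @ [i]) (ts ! (i - 1))) [1..<Suc (length ts)]"
  show ?case
  proof (cases "\<exists>p \<in> NPos \<mu> s. Fun f ts = subterm_at s p")
    case False
    then have nu: "\<not> (\<exists>p \<in> NPos \<nu> s. Fun f ts = subterm_at s p)"
      using NPos_antimono[OF 2(2), of s] by blast
    have eq: "(if \<exists>(l, r) \<in> R. unifiable_apart (Fun f (?args \<nu>)) l then Var (Fresh q)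
        else Fun f (?args \<nu>)) = Fun f (map (rename Orig) ts)"
      using 2(3) unfolding cap_at.simps Let_def if_not_P[OF nu] by simp
    have unif: "\<not> (\<exists>(l, r) \<in> R. unifiable_apart (Fun f (?args \<nu>)) l)"
    proof
      assume "\<exists>(l, r) \<in> R. unifiable_apart (Fun f (?args \<nu>)) l"
      from eq[unfolded if_P[OF this]] show False by (rule trm.distinct(1)[THEN notE])
    qed
    from eq[unfolded if_not_P[OF this]] have args: "?args \<nu> = map (rename Orig) ts"
      unfolding trm.inject by (rule conjunct2)
    have ith: "cap_at R \<nu> s (q @ [i]) (ts ! (i - 1)) = rename Orig (ts ! (i - 1))"
      if "i \<in> set [1..<Suc (length ts)]" for i
    proof -
      from that have i: "1 \<le> i" "i \<le> length ts" by auto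
      with arg_cong[OF args, of "\<lambda>xs. xs ! (i - 1)"] show ?thesis by (simp del: upt_Suc)
    qed
    have "?args \<mu> = ?args \<nu>"
    proof (rule map_cong[OF refl])
      fix i assume i: "i \<in> set [1..<Suc (length ts)]"
      show "cap_at R \<mu> s (q @ [i]) (ts ! (i - 1)) = cap_at R \<nu> s (q @ [i]) (ts ! (i - 1))"
        unfolding ith[OF i] by (rule 2(1)[OF nu i 2(2) ith[OF i]])
    qed
    with args unif show ?thesis
      unfolding cap_at.simps Let_def if_not_P[OF False] by (simp only: if_False trm.map)
  next
    case True
    show ?thesis unfolding cap_at.simps if_P[OF True] ..
  qed
qed

lemma Upsilon_mono: "mono (Upsilon R)"
proof (rule monoI, rule subrelI)
  fix \<mu> \<nu> :: "'a repl_map" and f i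
  assume "\<mu> \<subseteq> \<nu>" and "(f, i) \<in> Upsilon R \<mu>"
  moreover from this obtain l r p rs where "(l, r) \<in> R" "p \<in> Pos r" "subterm_at r p = Fun f rs"
      "1 \<le> i" "i \<le> length rs" "cap R \<mu> l (rs ! (i - 1)) \<noteq> rename Orig (rs ! (i - 1))"
    unfolding Upsilon_def by blast
  moreover from calculation have "cap R \<nu> l (rs ! (i - 1)) \<noteq> rename Orig (rs ! (i - 1))"
    unfolding cap_def using cap_at_antimono[of \<mu> \<nu> R l "[]" "rs ! (i - 1)"] by blast
  ultimately show "(f, i) \<in> Upsilon R \<nu>"
    unfolding Upsilon_def by blast
qed

lemma terms_subterm_at: "t \<in> terms F ar \<Longrightarrow> p \<in> Pos t \<Longrightarrow> subterm_at t p \<in> terms F ar"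
proof (induction t p rule: subterm_at.induct)
  case (2 f ts i p)
  from 2(2) have "\<And>t. t \<in> set ts \<Longrightarrow> t \<in> terms F ar" by cases
  with 2 show ?case by auto
qed auto

lemma Upsilon_replacement_map:
  assumes "trs F ar R"
  shows "replacement_map F ar (Upsilon R \<mu>)"
  unfolding replacement_map_def
proof clarify
  fix f i assume "(f, i) \<in> Upsilon R \<mu>"
  then obtain l r p rs where *: "(l, r) \<in> R" "p \<in> Pos r" "subterm_at r p = Fun f rs"
      "1 \<le> i" "i \<le> length rs"
    unfolding Upsilon_def by blast
  from assms *(1) have "r \<in> terms F ar" unfolding trs_def by blast
  from terms_subterm_at[OF this *(2)] have "Fun f rs \<in> terms F ar" using *(3) by simp
  then show "f \<in> F \<and> 1 \<le> i \<and> i \<le> ar f" using * by cases auto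
qed

lemma usable_map_fixed_point: "Upsilon R (usable_map R) = usable_map R"
  unfolding usable_map_def using lfp_unfold[OF Upsilon_mono] by (rule sym)

lemma usable_map_least: "Upsilon R \<mu> = \<mu> \<Longrightarrow> usable_map R \<subseteq> \<mu>"
  unfolding usable_map_def by (simp add: lfp_lowerbound)

lemma usable_map_replacement_map: "trs F ar R \<Longrightarrow> replacement_map F ar (usable_map R)"
  using Upsilon_replacement_map[of F ar R "usable_map R"] by (simp add: usable_map_fixed_point)

end

theory Submission
  imports Defs
begin

text \<open>Call a term safe for \<open>\<mu>\<close> if all its reducible subterms are at \<open>\<mu>\<close>-replacing positions. Let a safe
  term contain a redex \<open>l \<cdot> \<sigma>\<close>. If \<open>\<nu>\<close> is such that \<open>l \<cdot> \<sigma>\<close> is irreducible at the positions in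
  \<open>NPos \<nu> l\<close>, then capping leaves only those subterms \<open>t\<close> of \<open>r\<close> unchanged for which \<open>t \<cdot> \<sigma>\<close> is a normal
  form, so contracting the redex preserves safety as soon as \<open>Upsilon R \<nu> \<subseteq> \<mu>\<close>. For
  innermost steps \<open>\<nu> = {}\<close> qualifies, because the proper subterms of the redex are normal forms; for
  arbitrary steps \<open>\<nu> = \<mu>\<close> does, because the redex is itself safe.\<close>

section \<open>Rewriting, normal forms and positions\<close>

lemma innermost_rstep_subset_rstep: "innermost_rstep R \<subseteq> rstep R"
  unfolding innermost_rstep_def rstep_def by blast

lemma rstepI: "(l, r) \<in> R \<Longrightarrow> (plug C (l \<cdot> \<sigma>), plug C (r \<cdot> \<sigma>)) \<in> rstep R"
  unfolding rstep_def by blast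

lemma rstep_arg:
  assumes "(s, t) \<in> rstep R"
  shows "(Fun f (ss @ s # ts), Fun f (ss @ t # ts)) \<in> rstep R"
proof -
  from assms obtain l r C \<sigma> where
    "(l, r) \<in> R" "s = plug C (l \<cdot> \<sigma>)" "t = plug C (r \<cdot> \<sigma>)"
    unfolding rstep_def by blast
  then show ?thesis
    using rstepI[of l r R "More f ss C ts" \<sigma>] by simp
qed

lemma redex_not_NF: "(l, r) \<in> R \<Longrightarrow> l \<cdot> \<sigma> \<notin> NF R"
  using rstepI[of l r R Hole \<sigma>] unfolding NF_def by auto

lemma NF_args:
  assumes "Fun f ts \<in> NF R" "t \<in> set ts"
  shows "t \<in> NF R"
proof -
  from assms(2) obtain us vs where "ts = us @ t # vs"
    by (auto simp: in_set_conv_decomp)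
  with assms(1) show ?thesis
    unfolding NF_def using rstep_arg[of t _ R f us vs] by blast
qed

lemma NF_plug: "plug C t \<in> NF R \<Longrightarrow> t \<in> NF R"
  by (induction C) (auto dest: NF_args)

lemma Nil_in_Pos [simp]: "[] \<in> Pos t"
  by (cases t) auto

lemma Nil_in_RPos [simp]: "[] \<in> RPos \<mu> t"
  by (cases t) auto

lemma Cons_in_Pos:
  "i # p \<in> Pos (Fun f ts) \<longleftrightarrow> 1 \<le> i \<and> i \<le> length ts \<and> p \<in> Pos (ts ! (i - 1))"
  by auto

lemma Cons_in_RPos:
  "i # p \<in> RPos \<mu> (Fun f ts) \<longleftrightarrow>
    1 \<le> i \<and> i \<le> length ts \<and> (f, i) \<in> \<mu> \<and> p \<in> RPos \<mu> (ts ! (i - 1))"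
  by (force split: if_splits)

lemma NF_subterm_at: "t \<in> NF R \<Longrightarrow> p \<in> Pos t \<Longrightarrow> subterm_at t p \<in> NF R"
proof (induction t p rule: subterm_at.induct)
  case (2 f ts i p)
  then have "ts ! (i - 1) \<in> set ts" by (auto simp: Cons_in_Pos simp del: Pos.simps)
  with 2 show ?case by (auto simp: Cons_in_Pos simp del: Pos.simps dest: NF_args)
qed auto

lemma NF_FunI:
  assumes "\<And>t. t \<in> set ts \<Longrightarrow> t \<in> NF R"
    and "\<And>l r \<sigma>. (l, r) \<in> R \<Longrightarrow> Fun f ts \<noteq> l \<cdot> \<sigma>"
  shows "Fun f ts \<in> NF R"
proof (rule ccontr)
  assume "Fun f ts \<notin> NF R"
  then obtain l r C \<sigma> where lr: "(l, r) \<in> R" and eq: "Fun f ts = plug C (l \<cdot> \<sigma>)"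
    unfolding NF_def rstep_def by blast
  show False
  proof (cases C)
    case Hole
    with assms(2)[OF lr, of \<sigma>] eq show False by simp
  next
    case (More g us D vs)
    with eq assms(1) have "plug D (l \<cdot> \<sigma>) \<in> NF R" by simp
    with redex_not_NF[OF lr] NF_plug show False by blast
  qed
qed

section \<open>Positions under substitution\<close>

lemma Pos_subst: "p \<in> Pos t \<Longrightarrow> p \<in> Pos (t \<cdot> \<sigma>)"
  by (induction t p rule: subterm_at.induct)
    (auto simp: Cons_in_Pos simp del: Pos.simps(2))

lemma subterm_at_subst: "p \<in> Pos t \<Longrightarrow> subterm_at (t \<cdot> \<sigma>) p = subterm_at t p \<cdot> \<sigma>"
  by (induction t p rule: subterm_at.induct)
    (auto simp: Cons_in_Pos simp del: Pos.simps(2))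

text \<open>Whether a position of \<open>t\<close> is replacing depends only on the symbols above
  it, and these already lie in \<open>t\<close>. The contrapositive carries
  \<open>NPos \<mu> l\<close> over to non-replacing positions of
  \<open>l \<cdot> \<sigma>\<close>.\<close>

lemma RPos_subst: "p \<in> Pos t \<Longrightarrow> p \<in> RPos \<mu> (t \<cdot> \<sigma>) \<Longrightarrow> p \<in> RPos \<mu> t"
  by (induction t p rule: subterm_at.induct)
    (auto simp: Cons_in_Pos Cons_in_RPos simp del: Pos.simps(2) RPos.simps(2))

section \<open>Variable renamings and capped terms\<close>

lemma subst_map_trm: "map_trm (\<lambda>f. f) h t \<cdot> \<sigma> = t \<cdot> (\<sigma> \<circ> h)"
  by (induction t) auto

lemma map_trm_subst: "map_trm (\<lambda>f. f) h (t \<cdot> \<sigma>) = t \<cdot> (\<lambda>x. map_trm (\<lambda>f. f) h (\<sigma> x))"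
  by (induction t) auto

text \<open>The two substitutions may disagree on shared variables; once the variables are renamed
  apart, they combine into a single unifier.\<close>

lemma unifiable_apart_OrigI:
  fixes t l :: "('f, 'v) trm"
  assumes "t \<cdot> \<sigma> = l \<cdot> (\<tau> :: 'v \<Rightarrow> ('f, 'v) trm)"
  shows "unifiable_apart (rename Orig t) l"
proof -
  \<comment> \<open>Both instances are moved by \<open>Inr\<close> into the common variable type.
    The value at \<open>Fresh\<close> variables is arbitrary, since none occur in
    \<open>rename Orig t\<close>.\<close>
  define \<rho> :: "'v cvar + 'v \<Rightarrow> ('f, 'v cvar + 'v) trm" where
    "\<rho> = case_sum (case_cvar (\<lambda>x. rename Inr (\<sigma> x)) (\<lambda>_. undefined)) (\<lambda>y. rename Inr (\<tau> y))"
  have "rename Inl (rename Orig t) \<cdot> \<rho> = rename Inr (t \<cdot> \<sigma>)"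
    by (simp add: subst_map_trm map_trm_subst \<rho>_def comp_def)
  moreover have "rename Inr l \<cdot> \<rho> = rename Inr (l \<cdot> \<tau>)"
    by (simp add: subst_map_trm map_trm_subst \<rho>_def comp_def)
  ultimately show ?thesis
    unfolding unifiable_apart_def unifiable_def using assms by metis
qed

text \<open>A term survives capping for one of two reasons. Either it occurs at a position in
  \<open>NPos \<nu> l\<close>, where the second hypothesis applies, or its arguments survive and it
  unifies with no left-hand side; then the instances of the arguments are normal and a root redex
  would yield a unifier.\<close>

lemma cap_at_eq_NF:
  fixes R :: "('f, 'v) rules"
  assumes "cap_at R \<nu> l q t = rename Orig t"
    and "\<And>p. p \<in> NPos \<nu> l \<Longrightarrow> subterm_at l p \<cdot> (\<sigma> :: 'v \<Rightarrow> ('f, 'v) trm) \<in> NF R"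
  shows "t \<cdot> \<sigma> \<in> NF R"
  using assms
proof (induction R \<nu> l q t rule: cap_at.induct)
  case (1 R \<nu> s q x)
  \<comment> \<open>A variable that matches no non-replacing subterm becomes \<open>Fresh q\<close>,
    which is never \<open>Orig x\<close>.\<close>
  from 1(1) obtain p where p: "p \<in> NPos \<nu> s" "Var x = subterm_at s p"
    by (auto split: if_splits)
  from 1(2)[OF p(1)] show ?case by (simp only: p(2))
next
  case (2 R \<nu> s q f ts)
  let ?u = "Fun f (map (\<lambda>i. cap_at R \<nu> s (q @ [i]) (ts ! (i - 1))) [1..<Suc (length ts)])"
  show ?case
  proof (cases "\<exists>p \<in> NPos \<nu> s. Fun f ts = subterm_at s p")
    case True
    then obtain p where p: "p \<in> NPos \<nu> s" "Fun f ts = subterm_at s p" by blast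
    from 2(3)[OF p(1)] show ?thesis by (simp only: p(2))
  next
    case False
    have eq: "(if \<exists>(l, r) \<in> R. unifiable_apart ?u l then Var (Fresh q) else ?u)
        = rename Orig (Fun f ts)"
      using 2(2) unfolding cap_at.simps Let_def if_not_P[OF False] .
    have unif: "\<not> (\<exists>(l, r) \<in> R. unifiable_apart ?u l)"
    proof
      assume "\<exists>(l, r) \<in> R. unifiable_apart ?u l"
      from eq[unfolded if_P[OF this]] show False by simp
    qed
    have u: "?u = rename Orig (Fun f ts)"
      using eq unfolding if_not_P[OF unif] .
    have arg: "t \<cdot> \<sigma> \<in> NF R" if "t \<in> set ts" for t
    proof -
      from that obtain j where j: "j < length ts" "t = ts ! j" by (auto simp: in_set_conv_nth)
      \<comment> \<open>Argument indices start at 1, so the list entry \<open>j\<close> is argument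
        \<open>Suc j\<close>.\<close>
      then have mem: "Suc j \<in> set [1..<Suc (length ts)]" by auto
      from u have "map (\<lambda>i. cap_at R \<nu> s (q @ [i]) (ts ! (i - 1))) [1..<Suc (length ts)]
          = map (rename Orig) ts"
        by (simp del: upt_Suc)
      from arg_cong[OF this, of "\<lambda>xs. xs ! j"] j
      have "cap_at R \<nu> s (q @ [Suc j]) (ts ! (Suc j - 1)) = rename Orig (ts ! (Suc j - 1))"
        by (simp del: upt_Suc)
      from 2(1)[OF False mem this 2(3)] j show ?thesis by simp
    qed
    have root: "Fun f (map (\<lambda>t. t \<cdot> \<sigma>) ts) \<noteq> l \<cdot> \<tau>" if "(l, r) \<in> R" for l r \<tau>
    proof
      assume "Fun f (map (\<lambda>t. t \<cdot> \<sigma>) ts) = l \<cdot> \<tau>"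
      then have "unifiable_apart ?u l"
        unfolding u by (intro unifiable_apart_OrigI[of _ \<sigma> _ \<tau>]) simp
      with unif that show False by blast
    qed
    show ?thesis
      unfolding subst.simps using arg root by (intro NF_FunI) auto
  qed
qed

section \<open>Safe terms and their contexts\<close>

definition safe :: "('f, 'v) rules \<Rightarrow> 'f repl_map \<Rightarrow> ('f, 'v) trm \<Rightarrow> bool" where
  "safe R \<mu> t \<longleftrightarrow> (\<forall>p \<in> Pos t. subterm_at t p \<notin> NF R \<longrightarrow> p \<in> RPos \<mu> t)"

text \<open>Separates well-formedness, preserved by \<open>rstep_terms\<close>, from the condition
  on reducible subterms.\<close>

lemma T_mu_iff_safe: "t \<in> T_mu F ar R \<mu> \<longleftrightarrow> t \<in> terms F ar \<and> safe R \<mu> t"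
  unfolding T_mu_def safe_def by simp

lemma safe_mono: "\<mu> \<subseteq> \<nu> \<Longrightarrow> safe R \<mu> t \<Longrightarrow> safe R \<nu> t"
  unfolding safe_def using RPos_mono by blast

text \<open>A reducible subterm makes the argument containing it reducible, so at the root it
  suffices to test whole arguments. This turns safety into a structural recursion.\<close>

lemma safe_Fun:
  "safe R \<mu> (Fun f ts) \<longleftrightarrow>
    (\<forall>i < length ts. safe R \<mu> (ts ! i) \<and> (ts ! i \<notin> NF R \<longrightarrow> (f, Suc i) \<in> \<mu>))"
    (is "?L \<longleftrightarrow> ?R")
proof
  assume L: ?L
  show ?R
  proof (intro allI impI)
    fix i assume i: "i < length ts"
    have pos: "Suc i # p \<in> Pos (Fun f ts)" if "p \<in> Pos (ts ! i)" for p
      using that i by (simp add: Cons_in_Pos del: Pos.simps)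
    have repl: "(f, Suc i) \<in> \<mu> \<and> p \<in> RPos \<mu> (ts ! i)"
      if "p \<in> Pos (ts ! i)" "subterm_at (ts ! i) p \<notin> NF R" for p
    proof -
      have "Suc i # p \<in> RPos \<mu> (Fun f ts)"
        using L pos[OF that(1)] that(2) unfolding safe_def by fastforce
      then show ?thesis by (simp add: Cons_in_RPos del: RPos.simps)
    qed
    \<comment> \<open>The position \<open>[]\<close> handles the argument itself, the other
      positions its safety.\<close>
    from repl[of "[]"] repl show "safe R \<mu> (ts ! i) \<and> (ts ! i \<notin> NF R \<longrightarrow> (f, Suc i) \<in> \<mu>)"
      unfolding safe_def by auto
  qed
next
  assume R: ?R
  show ?L
    unfolding safe_def
  proof (intro ballI impI)
    fix p assume p: "p \<in> Pos (Fun f ts)" "subterm_at (Fun f ts) p \<notin> NF R"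
    show "p \<in> RPos \<mu> (Fun f ts)"
    proof (cases p)
      case (Cons i p')
      with p(1) have i: "1 \<le> i" "i \<le> length ts" "p' \<in> Pos (ts ! (i - 1))"
        by (auto simp: Cons_in_Pos simp del: Pos.simps)
      with R have "safe R \<mu> (ts ! (i - 1))" "ts ! (i - 1) \<notin> NF R \<longrightarrow> (f, i) \<in> \<mu>"
        by (auto dest: spec[where x = "i - 1"])
      moreover have "subterm_at (ts ! (i - 1)) p' \<notin> NF R" using p(2) Cons by simp
      ultimately show ?thesis
        using i NF_subterm_at[of "ts ! (i - 1)" R p'] Cons
        unfolding safe_def by (auto simp: Cons_in_RPos simp del: RPos.simps)
    qed simp
  qed
qed

lemma safe_plug: "safe R \<mu> (plug C s) \<Longrightarrow> s \<notin> NF R \<Longrightarrow> safe R \<mu> s"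
proof (induction C)
  case (More f us C vs)
  then show ?case by (auto simp: safe_Fun dest!: spec[where x = "length us"])
qed simp

text \<open>Every term on the path to the hole contains the reducible \<open>s\<close> and is
  reducible, so safety puts the whole path inside \<open>\<mu>\<close>. Hence even a reducible
  \<open>t\<close> is allowed there, and the siblings do not change.\<close>

lemma safe_replace:
  assumes "safe R \<mu> (plug C s)" "s \<notin> NF R" "safe R \<mu> t"
  shows "safe R \<mu> (plug C t)"
  using assms
proof (induction C)
  case (More f us C vs)
  from More(2) have args: "\<forall>i < length (us @ plug C s # vs). safe R \<mu> ((us @ plug C s # vs) ! i) \<and>
      ((us @ plug C s # vs) ! i \<notin> NF R \<longrightarrow> (f, Suc i) \<in> \<mu>)"
    by (simp add: safe_Fun)
  have "plug C s \<notin> NF R" using More(3) NF_plug by blast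
  with args[rule_format, of "length us"]
  have "safe R \<mu> (plug C s)" "(f, Suc (length us)) \<in> \<mu>" by auto
  with More have t: "safe R \<mu> (plug C t)" by simp
  have "safe R \<mu> ((us @ plug C t # vs) ! i) \<and>
      ((us @ plug C t # vs) ! i \<notin> NF R \<longrightarrow> (f, Suc i) \<in> \<mu>)"
    if i: "i < length (us @ plug C t # vs)" for i
  proof (cases "i = length us")
    case True
    with t \<open>(f, Suc (length us)) \<in> \<mu>\<close> show ?thesis by simp
  next
    case False
    then have "(us @ plug C t # vs) ! i = (us @ plug C s # vs) ! i"
      by (simp add: nth_append nth_Cons')
    with args[rule_format, of i] i show ?thesis by simp
  qed
  then show ?case by (simp add: safe_Fun)
qed simp

section \<open>Safety under substitution and contraction\<close>

lemma safe_subst_vars: "safe R \<mu> (t \<cdot> \<sigma>) \<Longrightarrow> x \<in> vars_trm t \<Longrightarrow> safe R \<mu> (\<sigma> x)"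
proof (induction t)
  case (Fun f ts)
  from Fun.prems(2) obtain i where i: "i < length ts" "x \<in> vars_trm (ts ! i)"
    by (auto simp: in_set_conv_nth)
  with Fun.prems(1) have "safe R \<mu> (ts ! i \<cdot> \<sigma>)" by (simp add: safe_Fun)
  with Fun.IH[OF nth_mem[OF i(1)]] i(2) show ?case by blast
qed simp

text \<open>By \<open>safe_Fun\<close>, the symbols of \<open>t\<close> only demand that arguments
  outside \<open>\<mu>\<close> become normal forms; below them, only the values
  \<open>\<sigma> x\<close> matter.\<close>

lemma safe_substI:
  assumes "\<And>x. x \<in> vars_trm t \<Longrightarrow> safe R \<mu> (\<sigma> x)"
    and "\<And>p f ts i. p \<in> Pos t \<Longrightarrow> subterm_at t p = Fun f ts \<Longrightarrow> i < length ts \<Longrightarrow>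
      (f, Suc i) \<notin> \<mu> \<Longrightarrow> ts ! i \<cdot> \<sigma> \<in> NF R"
  shows "safe R \<mu> (t \<cdot> \<sigma>)"
  using assms
proof (induction t)
  case (Fun f ts)
  have "safe R \<mu> (ts ! i \<cdot> \<sigma>) \<and> (ts ! i \<cdot> \<sigma> \<notin> NF R \<longrightarrow> (f, Suc i) \<in> \<mu>)" if i: "i < length ts" for i
  proof
    show "safe R \<mu> (ts ! i \<cdot> \<sigma>)"
    proof (rule Fun.IH)
      show "ts ! i \<in> set ts" using i by simp
      show "safe R \<mu> (\<sigma> x)" if "x \<in> vars_trm (ts ! i)" for x
        using Fun.prems(1)[of x] that nth_mem[OF i] by auto
      show "us ! j \<cdot> \<sigma> \<in> NF R"
        if "p \<in> Pos (ts ! i)" "subterm_at (ts ! i) p = Fun g us" "j < length us" "(g, Suc j) \<notin> \<mu>"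
        for p g us j
        using Fun.prems(2)[of "Suc i # p" g us j] that i by (simp add: Cons_in_Pos del: Pos.simps)
    qed
    show "ts ! i \<cdot> \<sigma> \<notin> NF R \<longrightarrow> (f, Suc i) \<in> \<mu>"
      using Fun.prems(2)[of "[]" f ts i] i by auto
  qed
  then show ?case by (simp add: safe_Fun)
qed simp

lemma safe_NPos_NF:
  assumes "safe R \<mu> (l \<cdot> \<sigma>)" "p \<in> NPos \<mu> l"
  shows "subterm_at l p \<cdot> \<sigma> \<in> NF R"
proof -
  from assms(2) have "p \<in> Pos l" "p \<notin> RPos \<mu> l" by (auto simp: NPos_def)
  with assms(1) show ?thesis
    unfolding safe_def using Pos_subst RPos_subst subterm_at_subst by metis
qed

text \<open>The values \<open>\<sigma> x\<close> are safe because they occur in the redex. An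
  argument in \<open>r\<close> outside \<open>\<mu>\<close> is outside
  \<open>Upsilon R \<nu>\<close>, so it survives capping and \<open>cap_at_eq_NF\<close> makes its
  instance normal.\<close>

lemma safe_contract:
  assumes "(l, r) \<in> R" "vars_trm r \<subseteq> vars_trm l" "Upsilon R \<nu> \<subseteq> \<mu>"
    and "safe R \<mu> (plug C (l \<cdot> \<sigma>))"
    and nf: "\<And>p. p \<in> NPos \<nu> l \<Longrightarrow> subterm_at l p \<cdot> \<sigma> \<in> NF R"
  shows "safe R \<mu> (plug C (r \<cdot> \<sigma>))"
proof (rule safe_replace[OF assms(4) redex_not_NF[OF assms(1)]])
  have redex: "safe R \<mu> (l \<cdot> \<sigma>)"
    using safe_plug[OF assms(4) redex_not_NF[OF assms(1)]] .
  show "safe R \<mu> (r \<cdot> \<sigma>)"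
  proof (rule safe_substI)
    show "safe R \<mu> (\<sigma> x)" if "x \<in> vars_trm r" for x
      using safe_subst_vars[OF redex] that assms(2) by blast
  next
    fix p f ts i
    assume p: "p \<in> Pos r" "subterm_at r p = Fun f ts" "i < length ts" "(f, Suc i) \<notin> \<mu>"
    then have "(f, Suc i) \<notin> Upsilon R \<nu>" using assms(3) by blast
    \<comment> \<open>The index \<open>Suc i - 1\<close> matches the argument count from 1 in
      \<open>Upsilon\<close>.\<close>
    then have "cap R \<nu> l (ts ! (Suc i - 1)) = rename Orig (ts ! (Suc i - 1))"
      unfolding Upsilon_def using assms(1) p(1-3) by fastforce
    then show "ts ! i \<cdot> \<sigma> \<in> NF R"
      unfolding cap_def using cap_at_eq_NF[OF _ nf] by simp
  qed
qed

section \<open>Well-formedness over the signature\<close>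

lemma terms_Fun:
  "Fun f ts \<in> terms F ar \<longleftrightarrow> f \<in> F \<and> length ts = ar f \<and> (\<forall>t \<in> set ts. t \<in> terms F ar)"
  by (auto intro: terms.intros elim: terms.cases)

lemma terms_subst_iff:
  "t \<in> terms F ar \<Longrightarrow> t \<cdot> \<sigma> \<in> terms F ar \<longleftrightarrow> (\<forall>x \<in> vars_trm t. \<sigma> x \<in> terms F ar)"
  by (induction t) (simp_all add: terms_Fun terms.intros(1))

lemma terms_plug: "plug C t \<in> terms F ar \<Longrightarrow> t \<in> terms F ar"
  by (induction C) (auto simp: terms_Fun)

lemma terms_plug_replace:
  "plug C s \<in> terms F ar \<Longrightarrow> t \<in> terms F ar \<Longrightarrow> plug C t \<in> terms F ar"
  by (induction C) (auto simp: terms_Fun)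

lemma rstep_terms:
  assumes "trs F ar R" "(s, t) \<in> rstep R" "s \<in> terms F ar"
  shows "t \<in> terms F ar"
proof -
  from assms(2) obtain l r C \<sigma> where
    *: "(l, r) \<in> R" "s = plug C (l \<cdot> \<sigma>)" "t = plug C (r \<cdot> \<sigma>)"
    unfolding rstep_def by blast
  from assms(1) *(1) have lr: "l \<in> terms F ar" "r \<in> terms F ar" "vars_trm r \<subseteq> vars_trm l"
    unfolding trs_def by auto
  have "l \<cdot> \<sigma> \<in> terms F ar" using assms(3) * terms_plug by blast
  with lr have "r \<cdot> \<sigma> \<in> terms F ar" by (auto simp: terms_subst_iff)
  with assms(3) * show ?thesis by (auto intro: terms_plug_replace)
qed

section \<open>Preservation of safety by rewrite steps\<close>

lemma rstep_safe:
  assumes "trs F ar R" "Upsilon R \<mu> \<subseteq> \<mu>" "(s, t) \<in> rstep R" "safe R \<mu> s"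
  shows "safe R \<mu> t"
proof -
  from assms(3) obtain l r C \<sigma> where
    *: "(l, r) \<in> R" "s = plug C (l \<cdot> \<sigma>)" "t = plug C (r \<cdot> \<sigma>)"
    unfolding rstep_def by blast
  have "vars_trm r \<subseteq> vars_trm l" using assms(1) *(1) unfolding trs_def by auto
  moreover have "safe R \<mu> (l \<cdot> \<sigma>)"
    using safe_plug assms(4) *(2) redex_not_NF[OF *(1)] by blast
  \<comment> \<open>Here \<open>\<nu>\<close> is \<open>\<mu>\<close> itself: safety of the redex
    gives normality at \<open>NPos \<mu> l\<close>.\<close>
  ultimately show ?thesis
    using safe_contract[OF *(1) _ assms(2)] safe_NPos_NF assms(4) * by blast
qed

lemma innermost_rstep_safe:
  assumes "trs F ar R" "(s, t) \<in> innermost_rstep R" "safe R (innermost_usable_map R) s"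
  shows "safe R (innermost_usable_map R) t"
proof -
  from assms(2) obtain l r C \<sigma> where
    *: "(l, r) \<in> R" "s = plug C (l \<cdot> \<sigma>)" "t = plug C (r \<cdot> \<sigma>)" and
    nf: "\<forall>p \<in> Pos (l \<cdot> \<sigma>). p \<noteq> [] \<longrightarrow> subterm_at (l \<cdot> \<sigma>) p \<in> NF R"
    unfolding innermost_rstep_def by blast
  have vars: "vars_trm r \<subseteq> vars_trm l" using assms(1) *(1) unfolding trs_def by auto
  have "subterm_at l p \<cdot> \<sigma> \<in> NF R" if "p \<in> NPos {} l" for p
  proof -
    \<comment> \<open>With the empty map only the root is replacing, so \<open>p\<close> denotes a
      proper subterm of the redex.\<close>
    from that have "p \<in> Pos l" "p \<noteq> []" by (auto simp: NPos_def)
    with nf show ?thesis using Pos_subst subterm_at_subst by metis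
  qed
  from safe_contract[OF *(1) vars _ _ this] show ?thesis
    using assms(3) * unfolding innermost_usable_map_def by blast
qed

section \<open>Reachable terms, by induction on the rewrite sequence\<close>

theorem theorem17:
  fixes F :: "'f set" and ar :: "'f \<Rightarrow> nat"
    and R :: "('f, 'v :: {countable, infinite}) rules"
  assumes "finite F" and "trs F ar R"
  shows "(\<forall>s \<in> T_mu F ar R {}. \<forall>t. (s, t) \<in> (innermost_rstep R)\<^sup>* \<longrightarrow>
            t \<in> T_mu F ar R (innermost_usable_map R))
       \<and> (\<forall>s \<in> T_mu F ar R {}. \<forall>t. (s, t) \<in> (rstep R)\<^sup>* \<longrightarrow>
            t \<in> T_mu F ar R (usable_map R))"
proof (intro conjI ballI allI impI)
  fix s t assume s: "s \<in> T_mu F ar R {}"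
  \<comment> \<open>The empty map lies below every \<open>\<mu>\<close>, so both inductions can
    start from \<open>s\<close>.\<close>
  then have start: "s \<in> T_mu F ar R \<mu>" for \<mu>
    using safe_mono[of "{}" \<mu>] by (auto simp: T_mu_iff_safe)
  show "t \<in> T_mu F ar R (innermost_usable_map R)" if "(s, t) \<in> (innermost_rstep R)\<^sup>*"
    using that
  proof induction
    case (step t u)
    then show ?case
      using rstep_terms[OF assms(2)] innermost_rstep_safe[OF assms(2)]
        innermost_rstep_subset_rstep[of R] by (auto simp: T_mu_iff_safe)
  qed (rule start)
  show "t \<in> T_mu F ar R (usable_map R)" if "(s, t) \<in> (rstep R)\<^sup>*"
    using that
  proof induction
    case (step t u)
    \<comment> \<open>The fixed point equation supplies the closure condition of
      \<open>rstep_safe\<close>.\<close>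
    then show ?case
      using rstep_terms[OF assms(2)] rstep_safe[OF assms(2), of "usable_map R"]
      by (auto simp: T_mu_iff_safe usable_map_fixed_point)
  qed (rule start)
qed

end
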